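(* Let $\{f_n\}\subset\mathcal{A}_C$, with primitives $F_n\in\mathcal{B}_C$, and let $F:\overline{\mathbb{R}}\to\mathbb{R}$. If $F_n\to F$ quasi-uniformly on $\overline{\mathbb{R}}$ then $F\in\mathcal{B}_C$ and $\int_{-\infty}^x f_n\to\int_{-\infty}^x F'$ for each $x\in\overline{\mathbb{R}}$, where $F'$ is the distributional derivative of $F$.
   Context: $\mathcal{D}=C_c^\infty(\mathbb{R})$ (real-valued), $\mathcal{D}'$ is the space of distributions, $\langle T',\phi\rangle=-\langle T,\phi'\rangle$; functions are identified with distributions in the usual way. $\overline{\mathbb{R}}=[-\infty,\infty]$. $C^0(\overline{\mathbb{R}})$ is the set of continuous real functions $F$ on $\mathbb{R}$ with real limits at $\pm\infty$, extended by $F(\pm\infty)=\lim_{\pm\infty}F$. $\mathcal{B}_C=\{F\in C^0(\overline{\mathbb{R}}): F(-\infty)=0\}$ and $\mathcal{A}_C=\{f\in\mathcal{D}': f=F' \text{ for some } F\in\mathcal{B}_C\}$; the primitive $F\in\mathcal{B}_C$ of $f\in\mathcal{A}_C$ is unique and $\int_{-\infty}^x f=F(x)$ for $x\in\overline{\mathbb{R}}$. Quasi-uniform convergence: let $\{F_n\}\subset C^0(\overline{\mathbb{R}})$ and $F:\overline{\mathbb{R}}\to\mathbb{R}$, and suppose $F_n(x)\to F(x)$ at each $x\in\overline{\mathbb{R}}$. Then $F_n\to F$ quasi-uniformly at $x\in\mathbb{R}$ if for each $\epsilon>0$ and each $N\in\mathbb{N}$ there are $\delta>0$ and $n\ge N$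 such that whenever $|x-y|<\delta$ we have $|F_n(y)-F(y)|<\epsilon$. For $x=\infty$ the condition $|x-y|<\delta$ is replaced with $y>1/\delta$, and for $x=-\infty$ with $y<-1/\delta$. Convergence is quasi-uniform on $\overline{\mathbb{R}}$ if it is pointwise on $\overline{\mathbb{R}}$ and quasi-uniform at each $x\in\overline{\mathbb{R}}$. *)

theory Defs
  imports "HOL-Analysis.Analysis"
begin

definition tsupport :: "(real \<Rightarrow> real) \<Rightarrow> real set" where
  "tsupport \<phi> = closure {x. \<phi> x \<noteq> 0}"

definition test_funs :: "(real \<Rightarrow> real) set" where
  "test_funs = {\<phi>. (\<forall>k x. (deriv ^^ k) \<phi> field_differentiable at x) \<and> compact (tsupport \<phi>)}"

definition test_converges :: "(nat \<Rightarrow> real \<Rightarrow> real) \<Rightarrow> (real \<Rightarrow> real) \<Rightarrow> bool" where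
  "test_converges \<phi> \<psi> \<longleftrightarrow>
     (\<exists>K. compact K \<and> (\<forall>n. tsupport (\<phi> n) \<subseteq> K)) \<and>
     (\<forall>k. uniform_limit UNIV (\<lambda>n. (deriv ^^ k) (\<phi> n)) ((deriv ^^ k) \<psi>) sequentially)"

text \<open>
  Distributions are represented by functionals that are \<^const>\<open>undefined\<close> off the test
  functions, so that HOL equality is equality of distributions. On test functions over the real
  line, continuity of a linear functional is the same as sequential continuity.
\<close>

definition distributions :: "((real \<Rightarrow> real) \<Rightarrow> real) set" where
  "distributions = {T \<in> extensional test_funs.
     (\<forall>\<phi>\<in>test_funs. \<forall>\<psi>\<in>test_funs. T (\<lambda>x. \<phi> x + \<psi> x) = T \<phi> + T \<psi>) \<and>
     (\<forall>c. \<forall>\<phi>\<in>test_funs. T (\<lambda>x. c * \<phi> x) = c * T \<phi>) \<and>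
     (\<forall>\<phi> \<psi>. (\<forall>n. \<phi> n \<in> test_funs) \<longrightarrow> \<psi> \<in> test_funs \<longrightarrow> test_converges \<phi> \<psi> \<longrightarrow>
        (\<lambda>n. T (\<phi> n)) \<longlonglongrightarrow> T \<psi>)}"

text \<open>Meaningful for locally integrable functions.\<close>

definition dist_of_fun :: "(real \<Rightarrow> real) \<Rightarrow> (real \<Rightarrow> real) \<Rightarrow> real" where
  "dist_of_fun g = (\<lambda>\<phi>\<in>test_funs. LINT x|lebesgue. g x * \<phi> x)"

definition dist_deriv :: "((real \<Rightarrow> real) \<Rightarrow> real) \<Rightarrow> (real \<Rightarrow> real) \<Rightarrow> real" where
  "dist_deriv T = (\<lambda>\<phi>\<in>test_funs. - T (deriv \<phi>))"

text \<open>The distributional derivative of the restriction to the real line.\<close>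

definition fun_deriv :: "(ereal \<Rightarrow> real) \<Rightarrow> (real \<Rightarrow> real) \<Rightarrow> real" where
  "fun_deriv F = dist_deriv (dist_of_fun (\<lambda>x. F (ereal x)))"

definition C0_ext :: "(ereal \<Rightarrow> real) set" where
  "C0_ext = {F. continuous_on UNIV (\<lambda>x::real. F (ereal x)) \<and>
     ((\<lambda>x::real. F (ereal x)) \<longlongrightarrow> F \<infinity>) at_top \<and>
     ((\<lambda>x::real. F (ereal x)) \<longlongrightarrow> F (-\<infinity>)) at_bot}"

definition B_C :: "(ereal \<Rightarrow> real) set" where
  "B_C = {F \<in> C0_ext. F (-\<infinity>) = 0}"

definition A_C :: "((real \<Rightarrow> real) \<Rightarrow> real) set" where
  "A_C = {f \<in> distributions. \<exists>F\<in>B_C. f = fun_deriv F}"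

definition primitive :: "((real \<Rightarrow> real) \<Rightarrow> real) \<Rightarrow> ereal \<Rightarrow> real" where
  "primitive f = (THE F. F \<in> B_C \<and> f = fun_deriv F)"

text \<open>The integral of \<open>f\<close> from \<open>-\<infinity>\<close> to \<open>x\<close>, for \<open>f \<in> A_C\<close>.\<close>

definition cp_integral :: "((real \<Rightarrow> real) \<Rightarrow> real) \<Rightarrow> ereal \<Rightarrow> real" where
  "cp_integral f x = primitive f x"

text \<open>
  The points \<open>y\<close> near \<open>\<plusminus>\<infinity>\<close> are taken to be real. Admitting \<open>y = \<plusminus>\<infinity>\<close> makes no difference for a
  pointwise convergent sequence, since the index \<open>n\<close> below may be taken arbitrarily large.
\<close>

definition near :: "ereal \<Rightarrow> real \<Rightarrow> real \<Rightarrow> bool" where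
  "near x \<delta> y = (case x of
       ereal r \<Rightarrow> \<bar>r - y\<bar> < \<delta>
     | PInfty \<Rightarrow> y > 1 / \<delta>
     | MInfty \<Rightarrow> y < - 1 / \<delta>)"

definition quasi_uniform_at :: "(nat \<Rightarrow> ereal \<Rightarrow> real) \<Rightarrow> (ereal \<Rightarrow> real) \<Rightarrow> ereal \<Rightarrow> bool" where
  "quasi_uniform_at Fn F x \<longleftrightarrow>
     (\<forall>\<epsilon>>0. \<forall>N. \<exists>\<delta>>0. \<exists>n\<ge>N. \<forall>y. near x \<delta> y \<longrightarrow> \<bar>Fn n (ereal y) - F (ereal y)\<bar> < \<epsilon>)"

definition quasi_uniform_limit :: "(nat \<Rightarrow> ereal \<Rightarrow> real) \<Rightarrow> (ereal \<Rightarrow> real) \<Rightarrow> bool" where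
  "quasi_uniform_limit Fn F \<longleftrightarrow>
     (\<forall>x. (\<lambda>n. Fn n x) \<longlonglongrightarrow> F x) \<and> (\<forall>x. quasi_uniform_at Fn F x)"

end

theory Submission
  imports Defs
begin

text \<open>
  The limit \<open>F\<close> inherits continuity and the limits at \<open>\<plusminus>\<infinity>\<close> by an \<open>\<epsilon>/3\<close> argument. The
  rest is uniqueness of primitives, which amounts to the statement that a continuous \<open>h\<close> with
  \<open>\<integral> h \<phi>' = 0\<close> for all test functions \<open>\<phi>\<close> is constant. If \<open>h a < h b\<close>, take for \<open>\<phi>\<close> the
  difference of two smooth step functions rising just to the right of \<open>a\<close> and of \<open>b\<close>, and let
  \<open>m\<close> be the mean of \<open>h a\<close> and \<open>h b\<close>: then \<open>(m - h) \<phi>'\<close> is nonnegative, nonzero and continuous,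
  but \<open>\<integral> (m - h) \<phi>' = 0\<close>.
\<close>

section \<open>Quasi-uniform limits\<close>

text \<open>Three errors of \<open>e / 3\<close>: from \<open>g y\<close> to \<open>G n y\<close>,
  from \<open>G n y\<close> to \<open>l n\<close>, from \<open>l n\<close> to \<open>l'\<close>. A
  single index \<open>n\<close> beyond \<open>N\<close> suffices, which is all that quasi-uniform
  convergence provides. The filter \<open>L\<close> treats real points and both infinities
  alike.\<close>

lemma tendsto_quasi_uniform:
  fixes G :: "nat \<Rightarrow> 'a \<Rightarrow> real"
  assumes unif: "\<And>\<epsilon> N. \<epsilon> > 0 \<Longrightarrow> \<exists>n\<ge>N. \<forall>\<^sub>F y in L. \<bar>G n y - g y\<bar> < \<epsilon>"
    and G: "\<And>n. (G n \<longlongrightarrow> l n) L"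
    and l: "l \<longlonglongrightarrow> l'"
  shows "(g \<longlongrightarrow> l') L"
proof (rule tendstoI)
  fix e :: real
  assume e: "e > 0"
  obtain N where N: "\<And>n. n \<ge> N \<Longrightarrow> \<bar>l n - l'\<bar> < e / 3"
    using LIMSEQ_D[OF l, of "e / 3"] e by auto
  obtain n where n: "n \<ge> N" and close: "\<forall>\<^sub>F y in L. \<bar>G n y - g y\<bar> < e / 3"
    using unif[of "e / 3" N] e by auto
  have "\<forall>\<^sub>F y in L. \<bar>G n y - l n\<bar> < e / 3"
    using tendstoD[OF G[of n], of "e / 3"] e by (simp add: dist_real_def)
  then show "\<forall>\<^sub>F y in L. dist (g y) l' < e"
    using close
  proof eventually_elim
    case (elim y)
    then show ?case
      using N[OF n] unfolding dist_real_def by linarith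
  qed
qed

lemma quasi_uniform_at_eventually:
  assumes "quasi_uniform_at Fn F x"
    and ev: "\<And>\<delta>. \<delta> > 0 \<Longrightarrow> \<forall>\<^sub>F y in L. near x \<delta> y"
    and "\<epsilon> > 0"
  shows "\<exists>n\<ge>N. \<forall>\<^sub>F y in L. \<bar>Fn n (ereal y) - F (ereal y)\<bar> < \<epsilon>"
proof -
  obtain \<delta> n where "\<delta> > 0" "n \<ge> N"
    and close: "\<And>y. near x \<delta> y \<Longrightarrow> \<bar>Fn n (ereal y) - F (ereal y)\<bar> < \<epsilon>"
    using assms(1,3) unfolding quasi_uniform_at_def by blast
  have "\<forall>\<^sub>F y in L. \<bar>Fn n (ereal y) - F (ereal y)\<bar> < \<epsilon>"
    using ev[OF \<open>\<delta> > 0\<close>] by (rule eventually_mono) (rule close)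
  with \<open>n \<ge> N\<close> show ?thesis
    by blast
qed

lemma C0_ext_quasi_uniform_limit:
  assumes Fn: "\<And>n. Fn n \<in> C0_ext" and lim: "quasi_uniform_limit Fn F"
  shows "F \<in> C0_ext"
proof -
  have pw: "\<And>x. (\<lambda>n. Fn n x) \<longlonglongrightarrow> F x" and qu: "\<And>x. quasi_uniform_at Fn F x"
    using lim by (auto simp: quasi_uniform_limit_def)
  \<comment> \<open>For each of the filters \<open>at x\<close>, \<open>at_top\<close> and
    \<open>at_bot\<close> it then remains to see that \<open>near\<close> holds eventually and that
    each \<open>Fn n\<close> converges.\<close>
  note transfer = tendsto_quasi_uniform[OF quasi_uniform_at_eventually[OF qu] _ pw]
  have "((\<lambda>y. F (ereal y)) \<longlongrightarrow> F (ereal x)) (at x)" for x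
  proof (rule transfer)
    show "\<forall>\<^sub>F y in at x. near (ereal x) \<delta> y" if "\<delta> > 0" for \<delta>
      using that unfolding near_def eventually_at
      by (intro exI[of _ \<delta>]) (auto simp: dist_real_def)
    show "((\<lambda>y. Fn n (ereal y)) \<longlongrightarrow> Fn n (ereal x)) (at x)" for n
      using Fn[of n] by (auto simp: C0_ext_def continuous_on_def)
  qed
  moreover have "((\<lambda>y. F (ereal y)) \<longlongrightarrow> F \<infinity>) at_top"
  proof (rule transfer)
    show "\<forall>\<^sub>F y in at_top. near \<infinity> \<delta> y" for \<delta>
      by (simp add: near_def eventually_gt_at_top)
    show "((\<lambda>y. Fn n (ereal y)) \<longlongrightarrow> Fn n \<infinity>) at_top" for n
      using Fn[of n] by (auto simp: C0_ext_def)
  qed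
  moreover have "((\<lambda>y. F (ereal y)) \<longlongrightarrow> F (-\<infinity>)) at_bot"
  proof (rule transfer)
    show "\<forall>\<^sub>F y in at_bot. near (-\<infinity>) \<delta> y" for \<delta>
      by (simp add: near_def)
    show "((\<lambda>y. Fn n (ereal y)) \<longlongrightarrow> Fn n (-\<infinity>)) at_bot" for n
      using Fn[of n] by (auto simp: C0_ext_def)
  qed
  ultimately show ?thesis
    by (auto simp: C0_ext_def continuous_on_def)
qed

section \<open>Smooth step functions\<close>

text \<open>The factors \<open>poly p\<close> and \<open>1 / (x (1 - x))\<^sup>m\<close> make this family closed under derivatives.\<close>

definition bump :: "real poly \<Rightarrow> nat \<Rightarrow> real \<Rightarrow> real" where
  "bump p m x = (if 0 < x \<and> x < 1
     then poly p x * inverse (x * (1 - x)) ^ m * exp (- inverse (x * (1 - x))) else 0)"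

text \<open>With \<open>t = inverse q\<close>, \<open>exp t\<close> dominates the term of index
  \<open>m + 2\<close> of its series; the two extra powers of \<open>t\<close> become the factor
  \<open>q\<^sup>2\<close>.\<close>

lemma inverse_power_exp_le:
  fixes q :: real
  assumes "q > 0"
  shows "inverse q ^ m * exp (- inverse q) \<le> fact (m + 2) * q\<^sup>2"
proof -
  define t where "t = inverse q"
  have t: "t > 0" "q = inverse t"
    using assms by (auto simp: t_def)
  have "(\<Sum>i\<in>{m + 2}. t ^ i /\<^sub>R fact i) \<le> (\<Sum>i. t ^ i /\<^sub>R fact i)"
    by (rule sum_le_suminf) (use t summable_exp_generic[of t] in auto)
  then have "t ^ (m + 2) / fact (m + 2) \<le> exp t"
    by (simp add: exp_def divide_inverse_commute del: fact_Suc power_Suc)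
  then have le: "t ^ m * t\<^sup>2 \<le> fact (m + 2) * exp t"
    by (simp only: pos_divide_le_eq fact_gt_zero power_add mult.commute[of "exp t"])
  have tq: "t\<^sup>2 * q\<^sup>2 = 1" and exp: "exp t * exp (- t) = 1"
    using t by (simp_all add: exp_minus_inverse flip: power_mult_distrib)
  have "t ^ m * exp (- t) = t ^ m * exp (- t) * (t\<^sup>2 * q\<^sup>2)"
    by (simp only: tq mult_1_right)
  also have "\<dots> = (t ^ m * t\<^sup>2) * (exp (- t) * q\<^sup>2)"
    by (simp only: mult_ac)
  also have "\<dots> \<le> (fact (m + 2) * exp t) * (exp (- t) * q\<^sup>2)"
    using le by (rule mult_right_mono) simp
  also have "\<dots> = fact (m + 2) * q\<^sup>2 * (exp t * exp (- t))"
    by (simp only: mult_ac)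
  also have "\<dots> = fact (m + 2) * q\<^sup>2"
    by (simp only: exp mult_1_right)
  finally show ?thesis
    by (simp only: t_def)
qed

text \<open>Inside the unit interval \<open>x * (1 - x)\<close> is at most the distance from
  \<open>x\<close> to any point \<open>y\<close> outside it, so the exponential estimate gives
  quadratic flatness, with one constant for all such \<open>y\<close>.\<close>

lemma bump_le_square:
  obtains C where "\<And>x y. y \<notin> {0<..<1} \<Longrightarrow> \<bar>bump p m x\<bar> \<le> C * (x - y)\<^sup>2"
proof -
  have "bounded (poly p ` {0..1})"
    by (intro compact_imp_bounded compact_continuous_image) (auto intro!: continuous_intros)
  then obtain B where B: "B > 0" "\<And>x. x \<in> {0..1} \<Longrightarrow> \<bar>poly p x\<bar> \<le> B"
    by (auto simp: bounded_pos)
  have "\<bar>bump p m x\<bar> \<le> B * fact (m + 2) * (x - y)\<^sup>2" if y: "y \<notin> {0<..<1}" for x y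
  proof (cases "0 < x \<and> x < 1")
    case True
    define q where "q = x * (1 - x)"
    have q: "q > 0" "q \<le> x" "q \<le> 1 - x"
      using True by (auto simp: q_def mult_le_cancel_left1 mult_le_cancel_right1)
    have "\<bar>q\<bar> \<le> \<bar>x - y\<bar>"
      using q y True by auto
    then have le: "q\<^sup>2 \<le> (x - y)\<^sup>2"
      by (simp add: abs_le_square_iff)
    have "\<bar>bump p m x\<bar> = \<bar>poly p x\<bar> * (inverse q ^ m * exp (- inverse q))"
      using True q by (simp add: bump_def abs_mult flip: q_def)
    also have "\<dots> \<le> B * (fact (m + 2) * q\<^sup>2)"
      using B True q by (intro mult_mono inverse_power_exp_le) auto
    also have "\<dots> \<le> B * (fact (m + 2) * (x - y)\<^sup>2)"
      using le B by (intro mult_left_mono) auto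
    finally show ?thesis
      by (simp add: mult_ac)
  next
    case False
    then have "bump p m x = 0"
      unfolding bump_def by (rule if_not_P)
    then show ?thesis
      using B by simp
  qed
  then show ?thesis
    using that by blast
qed

text \<open>The bound forces \<open>f y = 0\<close>, and the difference quotient is at most
  \<open>C * \<bar>x - y\<bar>\<close>.\<close>

lemma has_real_derivative_zero_if_le_square:
  fixes f :: "real \<Rightarrow> real"
  assumes "\<And>x. \<bar>f x\<bar> \<le> C * (x - y)\<^sup>2"
  shows "(f has_real_derivative 0) (at y)"
proof -
  have "f y = 0"
    using assms[of y] by simp
  have "((\<lambda>x. (f x - f y) / (x - y)) \<longlongrightarrow> 0) (at y)"
  proof (rule Lim_null_comparison)
    show "\<forall>\<^sub>F x in at y. norm ((f x - f y) / (x - y)) \<le> C * \<bar>x - y\<bar>"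
      unfolding eventually_at
    proof (intro exI[of _ 1] conjI ballI impI)
      fix x assume "x \<noteq> y \<and> dist x y < 1"
      then have pos: "\<bar>x - y\<bar> > 0" by simp
      have "\<bar>f x\<bar> \<le> C * \<bar>x - y\<bar> * \<bar>x - y\<bar>"
        using assms[of x] by (simp add: power2_eq_square mult.assoc abs_mult_self_eq)
      then show "norm ((f x - f y) / (x - y)) \<le> C * \<bar>x - y\<bar>"
        using pos \<open>f y = 0\<close> by (simp add: pos_divide_le_eq)
    qed simp
    have "((\<lambda>x. C * \<bar>x - y\<bar>) \<longlongrightarrow> C * \<bar>y - y\<bar>) (at y)"
      by (intro tendsto_intros)
    then show "((\<lambda>x. C * \<bar>x - y\<bar>) \<longlongrightarrow> 0) (at y)" by simp
  qed
  then show ?thesis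
    by (simp add: has_field_derivative_iff)
qed

text \<open>Inside the unit interval this is calculus; at every other point, endpoints included,
  quadratic flatness gives derivative 0.\<close>

lemma bump_has_derivative:
  obtains r k where "\<And>x. (bump p m has_real_derivative bump r k x) (at x)"
proof -
  define q :: "real poly" where "q = [:0, 1, -1:]"
  \<comment> \<open>The derivative of \<open>p q^-m exp(-1/q)\<close> is
    \<open>(p' q^-m - m p q' q^(-m-1) + p q' q^(-m-2)) exp(-1/q)\<close>; pulling out
    \<open>q^-(m+2)\<close> leaves the polynomial \<open>r\<close>.\<close>
  define r where "r = pderiv p * q\<^sup>2 - smult (of_nat m) (p * pderiv q * q) + p * pderiv q"
  have q: "poly q x = x * (1 - x)" for x
    by (simp add: q_def algebra_simps)
  have "(bump p m has_real_derivative bump r (m + 2) x) (at x)" for x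
  proof (cases "x \<in> {0<..<1}")
    case True
    then have pos: "poly q x > 0" by (simp add: q)
    define i E where "i = inverse (poly q x)" and "E = exp (- i)"
    have iq: "i * poly q x = 1"
      using pos by (simp add: i_def)
    \<comment> \<open>The power rule produces \<open>i ^ (m - 1)\<close> with truncated subtraction;
      for \<open>m = 0\<close> the factor \<open>of_nat m\<close> makes both sides 0.\<close>
    have m: "of_nat m * (i ^ (m - 1) * i\<^sup>2) = of_nat m * i ^ (m + 1)"
      by (cases m) (simp_all add: power2_eq_square)
    have "poly r x * i ^ (m + 2) = poly (pderiv p) x * i ^ m * (i * poly q x)\<^sup>2
        - of_nat m * i ^ (m + 1) * poly p x * poly (pderiv q) x * (i * poly q x)
        + poly p x * poly (pderiv q) x * i ^ (m + 2)"
      by (simp add: r_def algebra_simps power2_eq_square)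
    also have "\<dots> = poly (pderiv p) x * i ^ m
        - of_nat m * (i ^ (m - 1) * i\<^sup>2) * poly p x * poly (pderiv q) x
        + poly p x * poly (pderiv q) x * i ^ (m + 2)"
      by (simp only: iq m) simp
    finally have r: "poly r x * i ^ (m + 2) = \<dots>" .
    have dq: "((\<lambda>x. inverse (poly q x)) has_real_derivative - (poly (pderiv q) x * i\<^sup>2)) (at x)"
      using pos unfolding i_def
      by (auto intro!: derivative_eq_intros poly_DERIV simp: power2_eq_square mult_ac)
    have "((\<lambda>x. poly p x * inverse (poly q x) ^ m * exp (- inverse (poly q x))) has_real_derivative
        (poly (pderiv p) x * i ^ m
          + of_nat m * (- (poly (pderiv q) x * i\<^sup>2)) * i ^ (m - 1) * poly p x) * E
        + E * (poly (pderiv q) x * i\<^sup>2) * (poly p x * i ^ m)) (at x)"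
      unfolding i_def E_def
      by (rule derivative_eq_intros dq[unfolded i_def] poly_DERIV refl | simp)+
    also have "(poly (pderiv p) x * i ^ m
          + of_nat m * (- (poly (pderiv q) x * i\<^sup>2)) * i ^ (m - 1) * poly p x) * E
        + E * (poly (pderiv q) x * i\<^sup>2) * (poly p x * i ^ m) = poly r x * i ^ (m + 2) * E"
      unfolding r by (simp add: algebra_simps power2_eq_square)
    finally show ?thesis
      using True
      by (rule_tac has_field_derivative_transform_within_open[where S = "{0<..<1}"])
        (auto simp: bump_def q i_def E_def)
  next
    case False
    obtain C where "\<And>x y. y \<notin> {0<..<1} \<Longrightarrow> \<bar>bump p m x\<bar> \<le> C * (x - y)\<^sup>2"
      using bump_le_square by blast
    moreover have "bump r (m + 2) x = 0"
      using False by (auto simp: bump_def)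
    ultimately show ?thesis
      using has_real_derivative_zero_if_le_square[of "bump p m" C x] False by metis
  qed
  then show ?thesis
    using that by blast
qed

lemma continuous_on_bump: "continuous_on S (bump p m)"
  by (meson bump_has_derivative DERIV_isCont continuous_at_imp_continuous_on)

lemma bump_smult: "bump (smult c p) m x = c * bump p m x"
  by (simp add: bump_def)

text \<open>Reduces smoothness to a single differentiation: all iterated derivatives stay in a
  family closed under derivatives.\<close>

lemma higher_deriv_differentiable:
  fixes f :: "real \<Rightarrow> real"
  assumes "f \<in> P"
    and closed: "\<And>f. f \<in> P \<Longrightarrow> \<exists>g\<in>P. \<forall>x. (f has_real_derivative g x) (at x)"
  shows "(deriv ^^ k) f field_differentiable at x"
proof -
  have "(deriv ^^ k) f \<in> P" for k
  proof (induction k)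
    case (Suc k)
    then obtain g where "g \<in> P" "\<And>x. ((deriv ^^ k) f has_real_derivative g x) (at x)"
      using closed by blast
    then show ?case
      by (metis DERIV_imp_deriv ext funpow.simps(2) comp_apply)
  qed (use assms in simp)
  then show ?thesis
    using closed field_differentiable_def by blast
qed

section \<open>Steps and plateaus as test functions\<close>

definition step :: "real \<Rightarrow> real" where
  "step x = integral {0..x} (bump 1 0)"

lemma step_eq_0: "x \<le> 0 \<Longrightarrow> step x = 0"
  by (cases "x = 0") (auto simp: step_def)

text \<open>The integrand vanishes left of 0, so the base point may be moved left. This makes the
  fundamental theorem of calculus available at \<open>x \<le> 0\<close> too.\<close>

lemma integral_bump_eq_step:
  assumes "a \<le> 0" "a \<le> x"
  shows "integral {a..x} (bump 1 0) = step x"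
proof -
  have zero: "integral {a..y} (bump 1 0) = 0" if "y \<le> 0" for y
    using that by (intro integral_unique has_integral_is_0) (auto simp: bump_def)
  show ?thesis
  proof (cases "x \<le> 0")
    case True
    then show ?thesis
      using zero step_eq_0 by simp
  next
    case False
    then have "integral {a..0} (bump 1 0) + integral {0..x} (bump 1 0) = integral {a..x} (bump 1 0)"
      using assms by (intro Henstock_Kurzweil_Integration.integral_combine integrable_continuous_real)
        (auto simp: continuous_on_bump)
    then show ?thesis
      using zero by (simp add: step_def)
  qed
qed

text \<open>The final height \<open>step 1\<close> is not normalised, since it cancels in a
  plateau.\<close>

lemma step_eq_step_1:
  assumes "x \<ge> 1"
  shows "step x = step 1"
proof -
  have "integral {1..x} (bump 1 0) = 0"
    by (intro integral_unique has_integral_is_0) (auto simp: bump_def)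
  moreover have "integral {0..1} (bump 1 0) + integral {1..x} (bump 1 0) = integral {0..x} (bump 1 0)"
    using assms by (intro Henstock_Kurzweil_Integration.integral_combine integrable_continuous_real)
      (auto simp: continuous_on_bump)
  ultimately show ?thesis
    by (simp add: step_def)
qed

lemma step_has_derivative: "(step has_real_derivative bump 1 0 x) (at x)"
proof -
  \<comment> \<open>Strictly left of both 0 and \<open>x\<close>, so that \<open>x\<close> is
    interior and \<open>integral_bump_eq_step\<close> applies on a neighbourhood of it.\<close>
  define a where "a = min 0 x - 1"
  have "((\<lambda>y. integral {a..y} (bump 1 0)) has_real_derivative bump 1 0 x) (at x within {a..x + 1})"
    by (rule integral_has_real_derivative) (auto simp: a_def continuous_on_bump)
  then have "((\<lambda>y. integral {a..y} (bump 1 0)) has_real_derivative bump 1 0 x) (at x)"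
    by (simp add: at_within_Icc_at a_def)
  then show ?thesis
    by (rule has_field_derivative_transform_within_open[where S = "{a<..}"])
      (auto simp: a_def intro!: integral_bump_eq_step)
qed

text \<open>The outer factor \<open>e\<close> cancels the \<open>1 / e\<close> of the chain rule, so
  the derivative is a difference of two unscaled bumps. No order of \<open>a\<close> and
  \<open>b\<close> is assumed: for \<open>b < a\<close> the plateau is negative.\<close>

definition plateau :: "real \<Rightarrow> real \<Rightarrow> real \<Rightarrow> real \<Rightarrow> real" where
  "plateau e a b x = e * step ((x - a) / e) - e * step ((x - b) / e)"

lemma plateau_has_derivative:
  assumes "e > 0"
  shows "(plateau e a b has_real_derivative bump 1 0 ((x - a) / e) - bump 1 0 ((x - b) / e)) (at x)"
proof -
  have "((\<lambda>x. e * step ((x - c) / e)) has_real_derivative bump 1 0 ((x - c) / e)) (at x)" for c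
  proof -
    have "((\<lambda>x. (x - c) / e) has_real_derivative 1 / e) (at x)"
      using assms by (auto intro!: derivative_eq_intros)
    from DERIV_cmult[OF DERIV_chain2[OF step_has_derivative this], of e] show ?thesis
      using assms by simp
  qed
  then show ?thesis
    unfolding plateau_def[abs_def] by (intro DERIV_diff)
qed

lemma bump_scaled_eq_0:
  assumes "e > 0" "x \<notin> {c<..<c + e}"
  shows "bump p m ((x - c) / e) = 0"
  using assms by (auto simp: bump_def pos_divide_less_eq zero_less_divide_iff)

lemma plateau_eq_0:
  assumes "e > 0" "x \<notin> {min a b..max a b + e}"
  shows "plateau e a b x = 0"
proof (cases "x \<le> min a b")
  case True
  then have "(x - a) / e \<le> 0" "(x - b) / e \<le> 0"
    using assms(1) by (auto intro: divide_nonpos_pos)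
  then show ?thesis
    by (simp add: plateau_def step_eq_0)
next
  case False
  then have "x \<ge> a + e" "x \<ge> b + e"
    using assms(2) by auto
  then have "step ((x - a) / e) = step 1" "step ((x - b) / e) = step 1"
    using assms(1) by (intro step_eq_step_1; simp add: pos_le_divide_eq)+
  then show ?thesis
    by (simp add: plateau_def)
qed

lemma plateau_test_fun:
  assumes e: "e > 0"
  shows "plateau e a b \<in> test_funs"
proof -
  \<comment> \<open>The plateau is no difference of bumps, but its derivative is; from then on the
    two bumps are differentiated separately, each with its own polynomial and exponent.\<close>
  define P where "P = insert (plateau e a b)
    {\<lambda>x. bump p m ((x - a) / e) - bump r k ((x - b) / e) | p m r k. True}"
  have P_I: "(\<lambda>x. bump p m ((x - a) / e) - bump r k ((x - b) / e)) \<in> P" for p m r k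
    by (auto simp: P_def)
  \<comment> \<open>The chain rule factor \<open>1 / e\<close> is absorbed into the polynomial, so
    the family stays closed.\<close>
  have chain: "((\<lambda>x. bump p m ((x - c) / e)) has_real_derivative
      bump (smult (1 / e) p') m' ((x - c) / e)) (at x)"
    if "\<And>x. (bump p m has_real_derivative bump p' m' x) (at x)" for p m p' m' c x
  proof -
    have "((\<lambda>x. (x - c) / e) has_real_derivative 1 / e) (at x)"
      using e by (auto intro!: derivative_eq_intros)
    from DERIV_chain2[OF that this] show ?thesis
      by (simp add: bump_smult)
  qed
  have "\<exists>g\<in>P. \<forall>x. (f has_real_derivative g x) (at x)" if f_in: "f \<in> P" for f
  proof (cases "f = plateau e a b")
    case True
    then show ?thesis
      using plateau_has_derivative[OF e, of a b] by (intro bexI[OF _ P_I]) auto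
  next
    case False
    then obtain p m r k where f: "f = (\<lambda>x. bump p m ((x - a) / e) - bump r k ((x - b) / e))"
      using f_in by (auto simp: P_def)
    obtain p' m' where p': "\<And>x. (bump p m has_real_derivative bump p' m' x) (at x)"
      using bump_has_derivative by blast
    obtain r' k' where r': "\<And>x. (bump r k has_real_derivative bump r' k' x) (at x)"
      using bump_has_derivative by blast
    show ?thesis
      unfolding f using chain[OF p'] chain[OF r']
      by (intro bexI[OF _ P_I] allI DERIV_diff)
  qed
  then have "(deriv ^^ k) (plateau e a b) field_differentiable at x" for k x
    by (intro higher_deriv_differentiable[where P = P]) (auto simp: P_def)
  moreover have "tsupport (plateau e a b) \<subseteq> {min a b..max a b + e}"
    unfolding tsupport_def using plateau_eq_0[OF e, of _ a b]
    by (intro closure_minimal closed_atLeastAtMost subsetI) blast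
  then have "compact (tsupport (plateau e a b))"
    by (metis closed_closure closed_Int_compact compact_Icc inf.absorb1 tsupport_def)
  ultimately show ?thesis
    by (simp add: test_funs_def)
qed

section \<open>Uniqueness of primitives\<close>

lemma support_subset_tsupport: "x \<notin> tsupport \<phi> \<Longrightarrow> \<phi> x = 0"
  unfolding tsupport_def using closure_subset[of "{x. \<phi> x \<noteq> 0}"] by auto

lemma deriv_eq_0_outside_tsupport:
  assumes "x \<notin> tsupport \<phi>"
  shows "deriv \<phi> x = 0"
proof (rule DERIV_imp_deriv)
  show "(\<phi> has_real_derivative 0) (at x)"
  proof (rule has_field_derivative_transform_within_open)
    show "((\<lambda>_. 0) has_real_derivative 0) (at x)"
      by simp
    show "open (- tsupport \<phi>)"
      by (simp add: tsupport_def open_Compl)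
    show "x \<in> - tsupport \<phi>"
      using assms by simp
    show "0 = \<phi> y" if "y \<in> - tsupport \<phi>" for y
      using that support_subset_tsupport[of y \<phi>] by simp
  qed
qed

text \<open>A function vanishing on the open complement of its support has zero derivative there, so
  the support does not grow.\<close>

lemma deriv_test_fun:
  assumes "\<phi> \<in> test_funs"
  shows "deriv \<phi> \<in> test_funs"
proof -
  have "closed (tsupport \<phi>)"
    by (simp add: tsupport_def)
  moreover have "{x. deriv \<phi> x \<noteq> 0} \<subseteq> tsupport \<phi>"
    using deriv_eq_0_outside_tsupport[of _ \<phi>] by auto
  ultimately have "tsupport (deriv \<phi>) \<subseteq> tsupport \<phi>"
    unfolding tsupport_def[of "deriv \<phi>"] by (intro closure_minimal)
  moreover have "compact (tsupport \<phi>)"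
    using assms by (simp add: test_funs_def)
  ultimately have "compact (tsupport (deriv \<phi>))"
    by (metis closed_closure closed_Int_compact inf.absorb1 tsupport_def)
  moreover have "(deriv ^^ k) (deriv \<phi>) field_differentiable at x" for k x
  proof -
    have "(deriv ^^ Suc k) \<phi> field_differentiable at x"
      using assms unfolding test_funs_def by blast
    then show ?thesis
      by (simp add: funpow_Suc_right del: funpow.simps)
  qed
  ultimately show ?thesis
    by (simp add: test_funs_def)
qed

text \<open>Passes from the Lebesgue integral that defines \<open>dist_of_fun\<close> to the gauge
  integral on an interval, where the later computations take place.\<close>

lemma LINT_continuous_eq_integral:
  fixes g :: "real \<Rightarrow> real"
  assumes "continuous_on UNIV g" "\<And>x. x \<notin> {l..u} \<Longrightarrow> g x = 0"
  shows "(LINT x|lebesgue. g x) = integral {l..u} g"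
proof -
  have "g absolutely_integrable_on {l..u}"
    using assms(1) continuous_on_subset by (intro absolutely_integrable_continuous_real) blast
  then have "(LINT x:{l..u}|lebesgue. g x) = integral {l..u} g"
    by (rule set_lebesgue_integral_eq_integral)
  moreover have "indicator {l..u} x *\<^sub>R g x = g x" for x
    using assms(2) by (auto simp: indicator_def)
  ultimately show ?thesis
    by (simp only: set_lebesgue_integral_def)
qed

section \<open>Distributional derivatives tested on plateaus\<close>

lemma continuous_on_ereal_if_C0_ext:
  "F \<in> C0_ext \<Longrightarrow> continuous_on UNIV (\<lambda>x. F (ereal x))"
  by (simp add: C0_ext_def)

lemma fun_deriv_plateau:
  fixes a b e :: real
  assumes F: "F \<in> C0_ext" and e: "e > 0"
  defines "d \<equiv> \<lambda>x. bump 1 0 ((x - a) / e) - bump 1 0 ((x - b) / e)"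
  shows "fun_deriv F (plateau e a b) = - integral {min a b..max a b + e} (\<lambda>x. F (ereal x) * d x)"
proof -
  have "deriv (plateau e a b) = d"
    using plateau_has_derivative[OF e] unfolding d_def by (auto intro!: DERIV_imp_deriv)
  then have "fun_deriv F (plateau e a b) = - (LINT x|lebesgue. F (ereal x) * d x)"
    \<comment> \<open>Both functionals are restricted to test functions, so the plateau and its
      derivative must each be one before the definitions unfold.\<close>
    using deriv_test_fun[OF plateau_test_fun[OF e, of a b]] plateau_test_fun[OF e, of a b]
    by (simp add: fun_deriv_def dist_deriv_def dist_of_fun_def)
  also have "(LINT x|lebesgue. F (ereal x) * d x) = integral {min a b..max a b + e} (\<lambda>x. F (ereal x) * d x)"
  proof (rule LINT_continuous_eq_integral)
    show "continuous_on UNIV (\<lambda>x. F (ereal x) * d x)"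
      unfolding d_def using e
      by (intro continuous_intros continuous_on_ereal_if_C0_ext[OF F]
          continuous_on_compose2[OF continuous_on_bump[of UNIV]]) auto
    show "F (ereal x) * d x = 0" if "x \<notin> {min a b..max a b + e}" for x
    proof -
      have "x \<notin> {a<..<a + e}" "x \<notin> {b<..<b + e}"
        using that by auto
      then show ?thesis
        using bump_scaled_eq_0[OF e] by (simp add: d_def)
    qed
  qed
  finally show ?thesis .
qed

text \<open>An inequality for \<open>a\<close> and \<open>b\<close> in any order: exchanging them
  turns one contradiction argument into constancy of the difference.\<close>

lemma fun_deriv_eq_imp_diff_le:
  assumes F: "F \<in> C0_ext" and G: "G \<in> C0_ext" and eq: "fun_deriv F = fun_deriv G"
  shows "F (ereal b) - G (ereal b) \<le> F (ereal a) - G (ereal a)"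
proof (rule ccontr)
  define h where "h x = F (ereal x) - G (ereal x)" for x
  assume "\<not> ?thesis"
  then have less: "h a < h b"
    by (simp add: h_def)
  define m where "m = (h a + h b) / 2"
  have h: "continuous_on UNIV h"
    unfolding h_def by (intro continuous_intros continuous_on_ereal_if_C0_ext F G)
  then have "isCont h x" for x
    by (simp add: continuous_on_eq_continuous_at)
  then have "(h \<longlongrightarrow> h a) (at a)" "(h \<longlongrightarrow> h b) (at b)"
    by (auto simp: isCont_def)
  moreover have "h a < m" "m < h b"
    using less by (auto simp: m_def)
  ultimately have "\<forall>\<^sub>F x in at a. h x < m" "\<forall>\<^sub>F x in at b. m < h x"
    by (auto intro: order_tendstoD)
  then obtain e1 e2 where "e1 > 0" "e2 > 0"
    and e1: "\<And>x. x \<noteq> a \<Longrightarrow> \<bar>x - a\<bar> < e1 \<Longrightarrow> h x < m"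
    and e2: "\<And>x. x \<noteq> b \<Longrightarrow> \<bar>x - b\<bar> < e2 \<Longrightarrow> m < h x"
    unfolding eventually_at dist_real_def by blast
  \<comment> \<open>On the ramp of width \<open>e\<close> at \<open>a\<close> the values of
    \<open>h\<close> stay below \<open>m\<close>, on the one at \<open>b\<close> above
    \<open>m\<close>.\<close>
  define e where "e = min e1 e2"
  have e: "e > 0"
    using \<open>e1 > 0\<close> \<open>e2 > 0\<close> by (simp add: e_def)
  define d where "d x = bump 1 0 ((x - a) / e) - bump 1 0 ((x - b) / e)" for x
  define I where "I = {min a b..max a b + e}"
  have cont_d: "continuous_on UNIV d"
    unfolding d_def using e
    by (intro continuous_intros continuous_on_compose2[OF continuous_on_bump[of UNIV]]) auto
  have bump_pos: "bump 1 0 ((x - c) / e) > 0" if "x \<in> {c<..<c + e}" for x c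
    using that e by (simp add: bump_def pos_divide_less_eq)
  have bump_zero: "bump 1 0 ((x - c) / e) = 0" if "x \<notin> {c<..<c + e}" for x c
    by (rule bump_scaled_eq_0[OF e that])
  have near_a: "h x < m" if "x \<in> {a<..<a + e}" for x
    using that e1 by (auto simp: e_def)
  have near_b: "m < h x" if "x \<in> {b<..<b + e}" for x
    using that e2 by (auto simp: e_def)
  have nonneg: "(m - h x) * d x \<ge> 0" for x
  proof -
    \<comment> \<open>The ramps are disjoint: a common point would satisfy
      \<open>h x < m < h x\<close>.\<close>
    consider "x \<in> {a<..<a + e}" "x \<notin> {b<..<b + e}" | "x \<in> {b<..<b + e}" "x \<notin> {a<..<a + e}"
      | "x \<notin> {a<..<a + e}" "x \<notin> {b<..<b + e}"
      using near_a near_b by fastforce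
    then show ?thesis
    proof cases
      case 1
      then show ?thesis
        using bump_pos[of x a] bump_zero[of x b] near_a[of x] by (simp add: d_def)
    next
      case 2
      then show ?thesis
        using bump_pos[of x b] bump_zero[of x a] near_b[of x] by (simp add: d_def mult_le_0_iff)
    next
      case 3
      then show ?thesis
        using bump_zero by (simp add: d_def)
    qed
  qed
  have int: "(\<lambda>x. g x * d x) integrable_on I" if "continuous_on UNIV g" for g
    unfolding I_def using that cont_d
    by (intro integrable_continuous_real continuous_on_mult) (auto intro: continuous_on_subset)
  have "integral I (\<lambda>x. F (ereal x) * d x) = integral I (\<lambda>x. G (ereal x) * d x)"
    using fun_deriv_plateau[OF F e, of a b] fun_deriv_plateau[OF G e, of a b] eq
    by (simp add: d_def I_def)
  then have "integral I (\<lambda>x. h x * d x) = 0"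
    by (simp add: h_def left_diff_distrib int continuous_on_ereal_if_C0_ext F G
        Henstock_Kurzweil_Integration.integral_diff)
  \<comment> \<open>\<open>d\<close> is the derivative of a plateau that vanishes at both ends of
    \<open>I\<close>; hence replacing \<open>h\<close> by \<open>m - h\<close> keeps the integral
    0.\<close>
  moreover have "integral I d = 0"
  proof -
    have "(d has_integral plateau e a b (max a b + e) - plateau e a b (min a b)) I"
      unfolding I_def using plateau_has_derivative[OF e, of a b] e
      by (intro fundamental_theorem_of_calculus)
        (auto simp: d_def has_real_derivative_iff_has_vector_derivative[symmetric]
          intro: has_field_derivative_at_within)
    moreover have "plateau e a b (max a b + e) = 0"
    proof -
      have "step ((max a b + e - a) / e) = step 1" "step ((max a b + e - b) / e) = step 1"
        using e by (intro step_eq_step_1; simp add: pos_le_divide_eq)+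
      then show ?thesis
        by (simp add: plateau_def)
    qed
    moreover have "plateau e a b (min a b) = 0"
      using e by (simp add: plateau_def step_eq_0 divide_nonpos_pos)
    ultimately show ?thesis
      by (auto dest: integral_unique)
  qed
  ultimately have "integral I (\<lambda>x. (m - h x) * d x) = 0"
    using int[OF h] int[of "\<lambda>_. m"]
    by (simp add: left_diff_distrib Henstock_Kurzweil_Integration.integral_diff)
  moreover have "continuous_on I (\<lambda>x. (m - h x) * d x)"
    by (intro continuous_intros continuous_on_subset[OF h] continuous_on_subset[OF cont_d]) auto
  ultimately have zero: "\<forall>x\<in>I. (m - h x) * d x = 0"
    unfolding I_def using e nonneg by (subst (asm) integral_eq_0_iff) auto
  \<comment> \<open>At the midpoint of the ramp at \<open>a\<close> both factors are strictly
    positive, contradicting \<open>zero\<close>.\<close>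
  have "a + e / 2 \<in> {a<..<a + e}" "a + e / 2 \<in> I"
    using e by (auto simp: I_def)
  then have "d (a + e / 2) > 0" "m - h (a + e / 2) > 0"
    using near_a[of "a + e / 2"] near_b[of "a + e / 2"] bump_pos[of "a + e / 2" a]
      bump_zero[of "a + e / 2" b] by (force simp: d_def)+
  then show False
    using zero \<open>a + e / 2 \<in> I\<close> by auto
qed

text \<open>The constant difference on the reals has limit 0 at \<open>-\<infinity>\<close>, hence
  is 0; the limits at \<open>\<infinity>\<close> then agree as well.\<close>

lemma B_C_eqI:
  assumes F: "F \<in> B_C" and G: "G \<in> B_C" and eq: "fun_deriv F = fun_deriv G"
  shows "F = G"
proof -
  have C0: "F \<in> C0_ext" "G \<in> C0_ext" and bot: "F (-\<infinity>) = 0" "G (-\<infinity>) = 0"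
    using F G by (auto simp: B_C_def)
  define c where "c = F (ereal 0) - G (ereal 0)"
  have c: "F (ereal x) - G (ereal x) = c" for x
    unfolding c_def using fun_deriv_eq_imp_diff_le[OF C0 eq] by (intro antisym)
  have "((\<lambda>x. F (ereal x) - G (ereal x)) \<longlongrightarrow> F \<infinity> - G \<infinity>) at_top"
    "((\<lambda>x. F (ereal x) - G (ereal x)) \<longlongrightarrow> F (-\<infinity>) - G (-\<infinity>)) at_bot"
    using C0 by (auto simp: C0_ext_def intro!: tendsto_diff)
  then have "c = 0" "F \<infinity> = G \<infinity>"
    using bot by (auto simp: c tendsto_const_iff)
  show ?thesis
  proof
    show "F x = G x" for x
      using c \<open>c = 0\<close> \<open>F \<infinity> = G \<infinity>\<close> bot by (cases x) auto
  qed
qed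

text \<open>Uniqueness is what lets the \<open>THE\<close> in \<open>primitive\<close> denote
  \<open>F\<close>.\<close>

lemma cp_integral_fun_deriv:
  assumes "F \<in> B_C"
  shows "cp_integral (fun_deriv F) x = F x"
proof -
  have "primitive (fun_deriv F) = F"
    unfolding primitive_def
  proof (rule the_equality)
    show "G = F" if "G \<in> B_C \<and> fun_deriv F = fun_deriv G" for G
      using that B_C_eqI[OF _ assms, of G] by simp
  qed (simp add: assms)
  then show ?thesis
    by (simp add: cp_integral_def)
qed

theorem theorem16:
  fixes f :: "nat \<Rightarrow> (real \<Rightarrow> real) \<Rightarrow> real"
    and Fn :: "nat \<Rightarrow> ereal \<Rightarrow> real"
    and F :: "ereal \<Rightarrow> real"
  assumes "\<And>n. f n \<in> A_C"
    and "\<And>n. Fn n \<in> B_C"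
    and "\<And>n. f n = fun_deriv (Fn n)"
    and "quasi_uniform_limit Fn F"
  shows "F \<in> B_C \<and>
    (\<forall>x::ereal. (\<lambda>n. cp_integral (f n) x) \<longlonglongrightarrow> cp_integral (fun_deriv F) x)"
proof -
  have pw: "(\<lambda>n. Fn n x) \<longlonglongrightarrow> F x" for x
    using assms(4) unfolding quasi_uniform_limit_def by blast
  have Fn: "Fn n \<in> C0_ext" "Fn n (-\<infinity>) = 0" for n
    using assms(2)[of n] by (simp_all add: B_C_def)
  have "F (-\<infinity>) = 0"
    using pw[of "-\<infinity>"] unfolding Fn(2) by (simp only: LIMSEQ_const_iff)
  then have "F \<in> B_C"
    using C0_ext_quasi_uniform_limit[OF Fn(1) assms(4)] by (simp add: B_C_def)
  \<comment> \<open>Both integrals are now values of the primitives, so the claim is pointwise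
    convergence.\<close>
  then show ?thesis
    unfolding assms(3) cp_integral_fun_deriv[OF assms(2)] cp_integral_fun_deriv[OF \<open>F \<in> B_C\<close>]
    using pw by blast
qed

end
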